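(* Suppose $n \in \mathbb{N}$ is not a product of two primes and has prime factors (that is, its distinct prime divisors are exactly) $p_1 < p_2 < \cdots < p_r$ with $r\geq 2$. Then, for any $1 \leq k \leq r$, the set $\bigcup_{1\le i\le r,\ i \neq k}\langle \overline{p_ip_k}\rangle^*$ is a minimal separating set of $\widetilde{\mathcal{G}}(\mathbb{Z}_n)$.
   Context: $\mathbb{N}$ denotes the positive integers. $\mathbb{Z}_n=\{\overline{0},\overline{1},\ldots,\overline{n-1}\}$ is the additive group of integers modulo $n$, and $\overline{a}$ is the residue class of $a$. The power graph $\mathcal{G}(\mathbb{Z}_n)$ is the simple undirected graph with vertex set $\mathbb{Z}_n$ in which two distinct vertices are adjacent if one is a positive integer multiple of the other (i.e. one is a "power" of the other in additive notation). $\langle x\rangle$ is the cyclic subgroup generated by $x$, and $A^*=A\setminus\{\overline{0}\}$ for $A\subseteq\mathbb{Z}_n$. Let $\mathcal{S}(\mathbb{Z}_n)=\{\overline{a} : 1\le a<n,\ \gcd(a,n)=1\}\cup\{\overline{0}\}$ (the generators and the identity). $\widetilde{\mathcal{G}}(\mathbb{Z}_n)$ is the graph obtained from $\mathcal{G}(\mathbb{Z}_n)$ by deleting all vertices in $\mathcal{S}(\mathbb{Z}_n)$. A separating set of a graph $\Gamma$ is a set of vertices whose removal increases the number of components of $\Gamma$; it is minimal if none of its non-empty proper subsets disconnects $\Gamma$ when removed. *)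

theory Defs
  imports
    "HOL-Algebra.Elementary_Groups"
    "HOL-Computational_Algebra.Primes"
    "Graph_Theory.Graph_Theory"
begin

text \<open>
  Simple undirected graphs are represented, as in the library \<^theory>\<open>Graph_Theory.Digraph\<close>,
  by symmetric loop-free digraphs without multiple arcs. For a symmetric digraph the strongly
  connected components \<^const>\<open>pre_digraph.sccs\<close> are the connected components of the undirected
  graph. All graphs considered are finite; on a graph with infinitely many components the
  cardinality below would be the junk value 0.
\<close>

definition num_components :: "('a, 'b) pre_digraph \<Rightarrow> nat" where
  "num_components G = card (pre_digraph.sccs G)"

definition delete_verts :: "('a, 'b) pre_digraph \<Rightarrow> 'a set \<Rightarrow> ('a, 'b) pre_digraph" where
  "delete_verts G X = G \<restriction> (verts G - X)"

definition separating_set :: "('a, 'b) pre_digraph \<Rightarrow> 'a set \<Rightarrow> bool" where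
  "separating_set G X \<longleftrightarrow>
     X \<subseteq> verts G \<and> num_components (delete_verts G X) > num_components G"

definition minimal_separating_set :: "('a, 'b) pre_digraph \<Rightarrow> 'a set \<Rightarrow> bool" where
  "minimal_separating_set G X \<longleftrightarrow>
     separating_set G X \<and> (\<forall>Y. Y \<noteq> {} \<and> Y \<subset> X \<longrightarrow> \<not> separating_set G Y)"

text \<open>In additive notation \<open>x [^] m\<close> is the multiple \<open>m x\<close>; each edge is stored as two arcs.\<close>

definition power_graph :: "('a, 'b) monoid_scheme \<Rightarrow> 'a pair_pre_digraph" where
  "power_graph G = \<lparr> pverts = carrier G,
     parcs = {(x, y). x \<in> carrier G \<and> y \<in> carrier G \<and> x \<noteq> y \<and>
                (\<exists>m::nat. m > 0 \<and> (y = x [^]\<^bsub>G\<^esub> m \<or> x = y [^]\<^bsub>G\<^esub> m))} \<rparr>"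

lemma pair_graph_power_graph:
  assumes "finite (carrier G)"
  shows "pair_graph (power_graph G)"
proof
  have "parcs (power_graph G) \<subseteq> carrier G \<times> carrier G"
    by (auto simp: power_graph_def)
  then show "finite (parcs (power_graph G))"
    using assms by (meson finite_SigmaI finite_subset)
qed (use assms in \<open>auto simp: power_graph_def symmetric_def sym_def\<close>)

text \<open>
  \<^const>\<open>integer_mod_group\<close> represents the residue classes modulo \<open>n\<close> by \<open>0, \<dots>, n - 1\<close>.
\<close>

definition residue_class :: "nat \<Rightarrow> nat \<Rightarrow> int" where
  "residue_class n a = int a mod int n"

definition generators_and_identity :: "nat \<Rightarrow> int set" where
  "generators_and_identity n =
     {residue_class n a | a. 1 \<le> a \<and> a < n \<and> gcd a n = 1} \<union> {residue_class n 0}"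

definition reduced_power_graph :: "nat \<Rightarrow> (int, int \<times> int) pre_digraph" where
  "reduced_power_graph n =
     delete_verts (with_proj (power_graph (integer_mod_group n))) (generators_and_identity n)"

definition cyclic_subgroup_star :: "nat \<Rightarrow> int \<Rightarrow> int set" where
  "cyclic_subgroup_star n x = generate (integer_mod_group n) {x} - {residue_class n 0}"

end

theory Submission
  imports Defs
begin

text \<open>
  Write \<open>P\<close> for the chosen prime and \<open>V\<close> for the set of residues \<open>0 < x < n\<close> that are divisible
  by some prime factor of \<open>n\<close>; these are the vertices of the reduced graph. The set to be removed,
  \<open>X\<close>, consists of the elements of \<open>V\<close> divisible by \<open>P\<close> and by a second prime factor of \<open>n\<close>.
  So \<open>V - X\<close> splits into the vertices whose only prime factor in common with \<open>n\<close> is \<open>P\<close>, and those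
  not divisible by \<open>P\<close>.

  Reduction modulo \<open>n\<close> preserves divisibility by a divisor of \<open>n\<close>. Hence along an arc one endpoint
  inherits every prime factor that the other one shares with \<open>n\<close>, and an arc between the two
  parts is impossible: one endpoint would be divisible both by \<open>P\<close> and by another prime
  (\<open>not_reachable_without_mixed_multiples\<close>). Both parts are inhabited, by \<open>P\<close> and by any other prime
  factor, so removing \<open>X\<close> leaves at least two components.

  Conversely, a single \<open>x \<in> X\<close> put back suffices to connect everything
  (\<open>strongly_connected_if_mixed_multiple\<close>). Every vertex is adjacent or equal to each of its prime
  divisors that divide \<open>n\<close>. Distinct prime factors \<open>s\<close>, \<open>q\<close> other than \<open>P\<close> are joined through \<open>s * q\<close>,
  which lies outside \<open>X\<close> and is a nonzero residue because \<open>n\<close> is not a product of two primes; and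
  \<open>x\<close> itself joins \<open>P\<close> to some other prime factor. Applied with \<open>x\<close> an element that a proper subset
  of \<open>X\<close> misses, this shows that no proper subset separates; applied to the full vertex set, where
  \<open>P * Q\<close> can serve as \<open>x\<close>, it shows that the reduced graph is itself connected, so that two components
  are indeed an increase.
\<close>

section \<open>Counting components\<close>

lemma (in wf_digraph) num_components_strongly_connected:
  assumes "strongly_connected G"
  shows "num_components G = 1"
  using assms unfolding num_components_def strongly_connected_eq_iff by simp

lemma (in fin_digraph) num_components_ge_2:
  assumes "u \<in> verts G" "v \<in> verts G" "\<not> u \<rightarrow>\<^sup>* v"
  shows "num_components G \<ge> 2"
proof -
  have "scc_of u \<noteq> scc_of v"
    using assms in_scc_of_self[of v] by (auto simp: scc_of_def)
  then have "card {scc_of u, scc_of v} = 2" by simp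
  moreover have "{scc_of u, scc_of v} \<subseteq> sccs_verts"
    using assms by (simp add: scc_of_in_sccs_verts)
  ultimately show ?thesis
    unfolding num_components_def card_sccs_verts[symmetric]
    by (metis card_mono finite_sccs_verts)
qed

lemma delete_verts_induce_subgraph:
  "delete_verts (G \<restriction> S) Y = G \<restriction> (S - Y)"
  by (auto simp: delete_verts_def induce_subgraph_def)

section \<open>Divisibility and the power graph of the residue classes\<close>

abbreviation cyclic_power_graph :: "nat \<Rightarrow> (int, int \<times> int) pre_digraph" where
  "cyclic_power_graph n \<equiv> with_proj (power_graph (integer_mod_group n))"

lemma graph_cyclic_power_graph: "n > 0 \<Longrightarrow> graph (cyclic_power_graph n)"
  by (rule pair_graph.pair_graphD_graph, rule pair_graph_power_graph) (simp add: carrier_integer_mod_group)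

text \<open>
  The deleted graphs are all treated as subgraphs induced on a set of residues, in which
  reachability is symmetric.
\<close>

lemma graph_induce_cyclic_power_graph:
  assumes "n > 0" "S \<subseteq> {0..<int n}"
  shows "graph (cyclic_power_graph n \<restriction> S)"
proof -
  interpret graph "cyclic_power_graph n" using assms(1) by (rule graph_cyclic_power_graph)
  have "induced_subgraph (cyclic_power_graph n \<restriction> S) (cyclic_power_graph n)"
    using assms by (intro induced_induce) (simp add: power_graph_def carrier_integer_mod_group)
  then have "digraph (cyclic_power_graph n \<restriction> S)" "sym_digraph (cyclic_power_graph n \<restriction> S)"
    by (rule digraphI_induced, rule induced_graph_imp_graph)
  then show ?thesis
    by (simp add: graph_def pseudo_graph_def digraph_def)
qed

lemma dominates_cyclic_power_graph_iff:
  assumes "n > 0" "S \<subseteq> {0..<int n}"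
  shows "u \<rightarrow>\<^bsub>cyclic_power_graph n \<restriction> S\<^esub> v \<longleftrightarrow>
    u \<in> S \<and> v \<in> S \<and> u \<noteq> v \<and>
    (\<exists>m::nat. m > 0 \<and> (v = (int m * u) mod int n \<or> u = (int m * v) mod int n))"
  using assms
  by (auto simp: arcs_ends_def arc_to_ends_def image_iff power_graph_def carrier_integer_mod_group)

text \<open>
  Divisibility between the integer representatives is enough for adjacency: the quotient is a
  positive multiplier, and no reduction modulo \<open>n\<close> takes place. All paths below are built from such
  steps. The case \<open>u = v\<close> is the reason for speaking of reachability.
\<close>

lemma reachable_multiple:
  assumes "n > 0" "S \<subseteq> {0..<int n}" "u \<in> S" "v \<in> S" "0 < v" "u dvd v"
  shows "u \<rightarrow>\<^sup>*\<^bsub>cyclic_power_graph n \<restriction> S\<^esub> v" "v \<rightarrow>\<^sup>*\<^bsub>cyclic_power_graph n \<restriction> S\<^esub> u"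
proof -
  interpret graph "cyclic_power_graph n \<restriction> S"
    using assms by (intro graph_induce_cyclic_power_graph)
  obtain m where m: "v = u * m" using assms by blast
  have u: "0 < u" using assms m
    by (metis atLeastLessThan_iff mult_zero_left order_le_less subsetD)
  have "m > 0" using m u \<open>0 < v\<close> by (simp add: zero_less_mult_iff)
  have "v < int n" "0 \<le> v" using assms by auto
  then have "v = (int (nat m) * u) mod int n" "0 < nat m"
    using m \<open>m > 0\<close> by (simp_all add: mult.commute)
  then have "u = v \<or> u \<rightarrow>\<^bsub>cyclic_power_graph n \<restriction> S\<^esub> v"
    unfolding dominates_cyclic_power_graph_iff[OF assms(1,2)] using assms by blast
  then show "u \<rightarrow>\<^sup>*\<^bsub>cyclic_power_graph n \<restriction> S\<^esub> v" using assms by auto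
  then show "v \<rightarrow>\<^sup>*\<^bsub>cyclic_power_graph n \<restriction> S\<^esub> u" by (rule symmetric_reachable')
qed

text \<open>
  The obstruction to adjacency: a multiple of \<open>u\<close> modulo \<open>n\<close> keeps all divisors that \<open>u\<close> shares
  with \<open>n\<close>, because those divisors survive reduction modulo \<open>n\<close>.
\<close>

lemma dominates_dvd:
  assumes "n > 0" "S \<subseteq> {0..<int n}" "u \<rightarrow>\<^bsub>cyclic_power_graph n \<restriction> S\<^esub> v"
  shows "(\<forall>q. q dvd int n \<longrightarrow> q dvd u \<longrightarrow> q dvd v) \<or> (\<forall>q. q dvd int n \<longrightarrow> q dvd v \<longrightarrow> q dvd u)"
  using assms(3) unfolding dominates_cyclic_power_graph_iff[OF assms(1,2)]
  by (metis dvd_mod dvd_mult)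

section \<open>The vertices and the separating set\<close>

lemma residue_class_less: "a < n \<Longrightarrow> residue_class n a = int a"
  by (simp add: residue_class_def)

lemma gcd_neq_1_iff_prime_factor:
  assumes "n > (0::nat)"
  shows "gcd a n \<noteq> 1 \<longleftrightarrow> (\<exists>q\<in>prime_factors n. q dvd a)"
proof
  assume "gcd a n \<noteq> 1"
  then obtain q where "prime q" "q dvd gcd a n" using prime_factor_nat by blast
  then show "\<exists>q\<in>prime_factors n. q dvd a" using assms by (auto simp: in_prime_factors_iff)
next
  assume "\<exists>q\<in>prime_factors n. q dvd a"
  then obtain q where "prime q" "q dvd gcd a n" by (auto simp: in_prime_factors_iff)
  then show "gcd a n \<noteq> 1" using not_prime_unit by metis
qed

lemma verts_reduced_power_graph:
  assumes "n > 0"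
  shows "verts (reduced_power_graph n) =
    {x. 0 < x \<and> x < int n \<and> (\<exists>q\<in>prime_factors n. int q dvd x)}"
proof (intro Set.set_eqI iffI)
  fix x assume "x \<in> verts (reduced_power_graph n)"
  then have x: "0 \<le> x" "x < int n" and ngen: "x \<notin> generators_and_identity n"
    using assms by (auto simp: reduced_power_graph_def delete_verts_def power_graph_def
        carrier_integer_mod_group)
  from x obtain a where a: "x = int a" "a < n" by (metis nonneg_int_cases of_nat_less_iff)
  then have "a \<noteq> 0" using ngen by (auto simp: generators_and_identity_def residue_class_def)
  then have "gcd a n \<noteq> 1"
    using ngen a residue_class_less[OF a(2)] by (force simp: generators_and_identity_def)
  then show "x \<in> {x. 0 < x \<and> x < int n \<and> (\<exists>q\<in>prime_factors n. int q dvd x)}"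
    using a \<open>a \<noteq> 0\<close> gcd_neq_1_iff_prime_factor[OF assms, of a] by auto
next
  fix x assume x: "x \<in> {x. 0 < x \<and> x < int n \<and> (\<exists>q\<in>prime_factors n. int q dvd x)}"
  then obtain a where a: "x = int a" "a < n" "0 < a" using zero_less_imp_eq_int by fastforce
  then have "gcd a n \<noteq> 1" using x gcd_neq_1_iff_prime_factor[OF assms, of a] by auto
  then have "x \<notin> generators_and_identity n"
    using a by (auto simp: generators_and_identity_def residue_class_def)
  then show "x \<in> verts (reduced_power_graph n)"
    using x assms by (auto simp: reduced_power_graph_def delete_verts_def power_graph_def
        carrier_integer_mod_group)
qed

lemma reduced_power_graph_eq_induce:
  "reduced_power_graph n = cyclic_power_graph n \<restriction> verts (reduced_power_graph n)"
  by (simp add: reduced_power_graph_def delete_verts_def)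

text \<open>
  For a divisor \<open>d\<close> of \<open>n\<close>, reducing a multiple of \<open>d\<close> modulo \<open>n\<close> gives a multiple of \<open>d\<close> again. The case
  \<open>d = n\<close> is included: both sides are then empty.
\<close>

lemma cyclic_subgroup_star_residue_class:
  assumes "n > 0" "d dvd n"
  shows "cyclic_subgroup_star n (residue_class n d) = {x. 0 < x \<and> x < int n \<and> int d dvd x}"
proof -
  interpret group "integer_mod_group n" by simp
  have "residue_class n d \<in> carrier (integer_mod_group n)"
    using assms by (simp add: residue_class_def carrier_integer_mod_group)
  then have gen: "generate (integer_mod_group n) {residue_class n d} =
      {(k * residue_class n d) mod int n | k. k \<in> UNIV}"
    by (simp add: generate_pow int_pow_integer_mod_group)
  show ?thesis
  proof (intro Set.set_eqI iffI)
    fix x assume "x \<in> cyclic_subgroup_star n (residue_class n d)"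
    then obtain k where "x = (k * int d) mod int n" "x \<noteq> 0"
      unfolding cyclic_subgroup_star_def gen by (auto simp: residue_class_def mod_mult_right_eq)
    moreover have "0 \<le> (k * int d) mod int n" "(k * int d) mod int n < int n"
      using assms(1) by simp_all
    moreover have "int d dvd (k * int d) mod int n"
      using assms(2) by (intro dvd_mod) simp_all
    ultimately show "x \<in> {x. 0 < x \<and> x < int n \<and> int d dvd x}" by simp
  next
    fix x assume "x \<in> {x. 0 < x \<and> x < int n \<and> int d dvd x}"
    then have x: "0 < x" "x < int n" "int d dvd x" by simp_all
    then obtain k where "x = k * int d" by (metis dvd_def mult.commute)
    with x have "x = (k * int d) mod int n" "x \<noteq> 0" by (metis mod_pos_pos_trivial order_less_le)+
    then show "x \<in> cyclic_subgroup_star n (residue_class n d)"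
      unfolding cyclic_subgroup_star_def gen by (auto simp: residue_class_def mod_mult_right_eq)
  qed
qed

text \<open>
  The union of punctured subgroups in the theorem, described by divisibility alone; see
  \<open>Union_cyclic_subgroup_star_eq\<close>.
\<close>

definition mixed_multiples :: "nat \<Rightarrow> nat \<Rightarrow> int set" where
  "mixed_multiples n P =
     {x. 0 < x \<and> x < int n \<and> int P dvd x \<and> (\<exists>q\<in>prime_factors n - {P}. int q dvd x)}"

lemma prime_mult_dvd_int_iff:
  assumes "prime (p::nat)" "prime q" "p \<noteq> q"
  shows "int (p * q) dvd x \<longleftrightarrow> int p dvd x \<and> int q dvd x"
proof -
  have "coprime (int p) (int q)" using assms by (simp add: primes_coprime)
  then show ?thesis using divides_mult dvd_mult_left dvd_mult_right by (metis of_nat_mult)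
qed

lemma Union_cyclic_subgroup_star_eq:
  assumes "n > 0" "P \<in> prime_factors n"
  shows "(\<Union>q\<in>prime_factors n - {P}. cyclic_subgroup_star n (residue_class n (q * P))) =
    mixed_multiples n P"
proof -
  have "cyclic_subgroup_star n (residue_class n (q * P)) =
      {x. 0 < x \<and> x < int n \<and> int P dvd x \<and> int q dvd x}" if "q \<in> prime_factors n - {P}" for q
  proof -
    have q: "prime q" "q dvd n" "q \<noteq> P" and P: "prime P" "P dvd n"
      using that assms by (auto simp: in_prime_factors_iff)
    then have "q * P dvd n" using divides_mult[OF _ _ primes_coprime] by metis
    then show ?thesis
      using cyclic_subgroup_star_residue_class[OF assms(1)] prime_mult_dvd_int_iff[OF q(1) P(1) q(3)]
      by auto
  qed
  then show ?thesis by (auto simp: mixed_multiples_def)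
qed

section \<open>Connectivity\<close>

text \<open>
  This is where it matters that \<open>n\<close> is not a product of two primes: \<open>p * q\<close> divides \<open>n\<close>, so it can
  fail to be a nonzero residue only by being equal to \<open>n\<close>.
\<close>

lemma prime_mult_less:
  assumes "n > (0::nat)" "\<not> (\<exists>q1 q2. prime q1 \<and> prime q2 \<and> n = q1 * q2)"
    and "p \<in> prime_factors n" "q \<in> prime_factors n" "p \<noteq> q"
  shows "p * q < n"
proof -
  have "prime p" "prime q" "p dvd n" "q dvd n" using assms by (auto simp: in_prime_factors_iff)
  moreover from this have "p * q dvd n" using divides_mult[OF _ _ primes_coprime] assms(5) by metis
  moreover have "p * q \<noteq> n" using \<open>prime p\<close> \<open>prime q\<close> assms(2) by metis
  ultimately show ?thesis using assms(1) by (meson dvd_imp_le le_neq_implies_less)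
qed

text \<open>
  All vertices reach the hub \<open>P\<close>. With \<open>q\<close> a prime factor of \<open>n\<close> other than \<open>P\<close> that divides \<open>x\<close>, the
  longest path needed leads from a vertex \<open>v\<close> through \<open>s\<close>, \<open>s * q\<close>, \<open>q\<close> and \<open>x\<close> to \<open>P\<close>, where \<open>s\<close> is a
  prime factor of \<open>n\<close> dividing \<open>v\<close>. Only \<open>x\<close> and possibly \<open>v\<close> lie in the removed set.
\<close>

lemma strongly_connected_if_mixed_multiple:
  assumes n: "n > 0" "\<not> (\<exists>q1 q2. prime q1 \<and> prime q2 \<and> n = q1 * q2)"
    and P: "P \<in> prime_factors n"
    and x: "x \<in> mixed_multiples n P" "x \<in> S"
    and S: "verts (reduced_power_graph n) - mixed_multiples n P \<subseteq> S"
           "S \<subseteq> verts (reduced_power_graph n)"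
  shows "strongly_connected (cyclic_power_graph n \<restriction> S)"
proof -
  let ?G = "cyclic_power_graph n \<restriction> S"
  have V: "verts (reduced_power_graph n) =
      {x. 0 < x \<and> x < int n \<and> (\<exists>q\<in>prime_factors n. int q dvd x)}"
    using verts_reduced_power_graph[OF n(1)] .
  have sub: "S \<subseteq> {0..<int n}" and pos: "\<And>v. v \<in> S \<Longrightarrow> 0 < v" using S(2) V by auto
  interpret graph ?G using n(1) sub by (rule graph_induce_cyclic_power_graph)
  obtain q where q: "q \<in> prime_factors n" "q \<noteq> P" "int q dvd x" "int P dvd x"
    using x by (auto simp: mixed_multiples_def)
  have not_dvd: "\<not> s dvd t" if "s \<in> prime_factors n" "t \<in> prime_factors n" "s \<noteq> t" for s t :: nat
    using that primes_dvd_imp_eq by (metis in_prime_factors_iff)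
  have prime_in: "int s \<in> S" if s: "s \<in> prime_factors n" for s
  proof -
    \<comment> \<open>A second prime factor \<open>t\<close> keeps \<open>s\<close> below \<open>n\<close>, hence a nonzero residue.\<close>
    obtain t where t: "t \<in> prime_factors n" "t \<noteq> s" using P q s by blast
    have "0 < s" "0 < t" using s t by (auto simp: in_prime_factors_iff prime_gt_0_nat)
    then have "s \<le> s * t" by simp
    then have "s < n" using prime_mult_less[OF n s t(1)] t(2) by linarith
    have "\<exists>q\<in>prime_factors n. int q dvd int s" by (rule bexI[OF _ s]) simp
    then have "int s \<in> verts (reduced_power_graph n)"
      using \<open>s < n\<close> \<open>0 < s\<close> unfolding V by simp
    moreover have "int s \<notin> mixed_multiples n P"
      using not_dvd s P by (auto simp: mixed_multiples_def)
    ultimately show ?thesis using S by blast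
  qed
  have x_P: "x \<rightarrow>\<^sup>*\<^bsub>?G\<^esub> int P"
    using reachable_multiple(2)[OF n(1) sub prime_in[OF P] x(2)] pos x(2) q by blast
  have q_P: "int q \<rightarrow>\<^sup>*\<^bsub>?G\<^esub> int P"
    using reachable_multiple(1)[OF n(1) sub prime_in[OF q(1)] x(2)] pos x(2) q x_P
      reachable_trans by blast
  have prime_P: "int s \<rightarrow>\<^sup>*\<^bsub>?G\<^esub> int P" if s: "s \<in> prime_factors n" "s \<noteq> P" for s
  proof (cases "s = q")
    case True
    then show ?thesis using q_P by simp
  next
    case False
    have "\<not> P dvd s * q"
      using not_dvd[OF P s(1)] not_dvd[OF P q(1)] s q P
      by (metis in_prime_factors_iff prime_dvd_mult_iff)
    then have "int (s * q) \<notin> mixed_multiples n P"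
      unfolding mixed_multiples_def by (auto simp del: of_nat_mult)
    moreover have pos_sq: "0 < int (s * q)"
      using s q by (auto simp: in_prime_factors_iff prime_gt_0_nat)
    moreover have "int (s * q) < int n" using prime_mult_less[OF n s(1) q(1) False] by linarith
    moreover have "\<exists>t\<in>prime_factors n. int t dvd int (s * q)"
      by (rule bexI[OF _ s(1)]) simp
    ultimately have sq: "int (s * q) \<in> S" using S(1) V by blast
    have "int s \<rightarrow>\<^sup>*\<^bsub>?G\<^esub> int (s * q)"
      by (rule reachable_multiple(1)[OF n(1) sub prime_in[OF s(1)] sq pos_sq]) simp
    also have "int (s * q) \<rightarrow>\<^sup>*\<^bsub>?G\<^esub> int q"
      by (rule reachable_multiple(2)[OF n(1) sub prime_in[OF q(1)] sq pos_sq]) simp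
    also note q_P
    finally show ?thesis .
  qed
  have to_P: "v \<rightarrow>\<^sup>*\<^bsub>?G\<^esub> int P" if v: "v \<in> S" for v
  proof -
    obtain s where s: "s \<in> prime_factors n" "int s dvd v" using v S(2) V by blast
    have "v \<rightarrow>\<^sup>*\<^bsub>?G\<^esub> int s" by (rule reachable_multiple(2)[OF n(1) sub prime_in[OF s(1)] v pos[OF v] s(2)])
    also have "int s \<rightarrow>\<^sup>*\<^bsub>?G\<^esub> int P" using prime_P[OF s(1)] prime_in[OF P] by (cases "s = P") auto
    finally show ?thesis .
  qed
  show ?thesis
    unfolding strongly_connected_def
    using to_P symmetric_reachable' reachable_trans x(2)
    by (metis empty_iff induce_subgraph_verts)
qed

text \<open>
  Divisibility by \<open>P\<close> is an invariant of paths avoiding the removed set. A vertex \<open>z\<close> that violates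
  it after a vertex \<open>y\<close> divisible by \<open>P\<close> has some other prime factor \<open>q\<close>; as \<open>z\<close> does not inherit \<open>P\<close> from
  \<open>y\<close>, it is \<open>y\<close> that inherits \<open>q\<close> from \<open>z\<close>, which puts \<open>y\<close> in the removed set.
\<close>

lemma not_reachable_without_mixed_multiples:
  assumes n: "n > 0" and P: "P \<in> prime_factors n"
    and S: "S = verts (reduced_power_graph n) - mixed_multiples n P"
    and reach: "u \<rightarrow>\<^sup>*\<^bsub>cyclic_power_graph n \<restriction> S\<^esub> v" and u: "int P dvd u"
  shows "int P dvd v"
proof -
  have V: "S = {x. 0 < x \<and> x < int n \<and> (\<exists>q\<in>prime_factors n. int q dvd x)} - mixed_multiples n P"
    using S verts_reduced_power_graph[OF n] by simp
  have sub: "S \<subseteq> {0..<int n}" using V by auto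
  interpret graph "cyclic_power_graph n \<restriction> S"
    using n sub by (rule graph_induce_cyclic_power_graph)
  from reach show ?thesis
  proof (induction rule: reachable_induct)
    case base
    show ?case by (fact u)
  next
    case (step y z)
    have yz: "y \<in> S" "z \<in> S" using adj_in_verts[OF step(2)] by auto
    show ?case
    proof (rule ccontr)
      assume nz: "\<not> int P dvd z"
      obtain q where q: "q \<in> prime_factors n" "int q dvd z" "q \<noteq> P" using yz(2) V nz by blast
      have dvdn: "int q dvd int n" "int P dvd int n"
        using q P by (auto simp: in_prime_factors_iff)
      have "int q dvd y"
        using dominates_dvd[OF n sub step(2)] dvdn step(3) nz q(2) by blast
      then have "y \<in> mixed_multiples n P"
        using yz(1) V step(3) q by (auto simp: mixed_multiples_def)
      then show False using yz(1) V by blast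
    qed
  qed
qed

lemma minimal_separating_set_mixed_multiples:
  assumes n: "n > 0" "\<not> (\<exists>q1 q2. prime q1 \<and> prime q2 \<and> n = q1 * q2)"
    and P: "P \<in> prime_factors n" and Q: "Q \<in> prime_factors n" "Q \<noteq> P"
  shows "minimal_separating_set (reduced_power_graph n) (mixed_multiples n P)"
proof -
  let ?V = "verts (reduced_power_graph n)" and ?X = "mixed_multiples n P"
  have V: "?V = {x. 0 < x \<and> x < int n \<and> (\<exists>q\<in>prime_factors n. int q dvd x)}"
    using verts_reduced_power_graph[OF n(1)] .
  have pos: "0 < P" "0 < Q" using P Q by (auto simp: in_prime_factors_iff prime_gt_0_nat)
  have less: "Q * P < n" using prime_mult_less[OF n Q(1) P Q(2)] .
  have XV: "?X \<subseteq> ?V" using V by (auto simp: mixed_multiples_def)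
  have del: "delete_verts (reduced_power_graph n) Y = cyclic_power_graph n \<restriction> (?V - Y)" for Y
    by (metis delete_verts_induce_subgraph reduced_power_graph_eq_induce)
  have one: "num_components (cyclic_power_graph n \<restriction> (?V - Y)) = 1" if Y: "Y \<subset> ?X" for Y
  proof -
    obtain x where "x \<in> ?X" "x \<notin> Y" using Y by blast
    then have "strongly_connected (cyclic_power_graph n \<restriction> (?V - Y))"
      using Y XV by (intro strongly_connected_if_mixed_multiple[OF n P]) auto
    moreover have "graph (cyclic_power_graph n \<restriction> (?V - Y))"
      using n V by (intro graph_induce_cyclic_power_graph) auto
    ultimately show ?thesis
      by (simp add: graph_def digraph_def fin_digraph_def wf_digraph.num_components_strongly_connected)
  qed
  \<comment> \<open>The removed set is nonempty, so the empty set is one of its proper subsets.\<close>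
  have "int (Q * P) \<in> ?X" using less pos P Q unfolding mixed_multiples_def
    by (auto intro!: bexI[of _ Q] simp flip: of_nat_mult)
  then have comp1: "num_components (reduced_power_graph n) = 1"
    using one[of "{}"] reduced_power_graph_eq_induce[of n] by auto
  have comp2: "num_components (cyclic_power_graph n \<restriction> (?V - ?X)) \<ge> 2"
  proof -
    interpret graph "cyclic_power_graph n \<restriction> (?V - ?X)"
      using n V by (intro graph_induce_cyclic_power_graph) auto
    have primes: "prime P" "prime Q" using P Q by (auto simp: in_prime_factors_iff)
    have ndvd: "\<not> P dvd Q" using primes Q(2) primes_dvd_imp_eq by blast
    have "P \<le> Q * P" "Q \<le> Q * P" using pos by simp_all
    then have "P < n" "Q < n" using less by linarith+
    moreover have "\<exists>q\<in>prime_factors n. int q dvd int P" "\<exists>q\<in>prime_factors n. int q dvd int Q"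
      by (rule bexI[OF _ P], simp, rule bexI[OF _ Q(1)], simp)
    ultimately have "int P \<in> ?V" "int Q \<in> ?V" using pos unfolding V by simp_all
    moreover have "int P \<notin> ?X" "int Q \<notin> ?X"
      using primes Q ndvd by (auto simp: mixed_multiples_def in_prime_factors_iff primes_dvd_imp_eq)
    ultimately show ?thesis
      using not_reachable_without_mixed_multiples[OF n(1) P refl, of "int P" "int Q"] ndvd
      by (intro num_components_ge_2[of "int P" "int Q"]) auto
  qed
  show ?thesis
    unfolding minimal_separating_set_def separating_set_def del
    using XV comp1 comp2 one by auto
qed

theorem theorem2p11:
  fixes n r k :: nat and p :: "nat \<Rightarrow> nat"
  assumes "n > 0"
    and "\<not> (\<exists>q1 q2. prime q1 \<and> prime q2 \<and> n = q1 * q2)"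
    and "r \<ge> 2"
    and "strict_mono_on {1..r} p"
    and "prime_factors n = p ` {1..r}"
    and "1 \<le> k" and "k \<le> r"
  shows "minimal_separating_set (reduced_power_graph n)
           (\<Union>i\<in>{1..r} - {k}. cyclic_subgroup_star n (residue_class n (p i * p k)))"
proof -
  have inj: "inj_on p {1..r}" using assms(4) by (rule strict_mono_on_imp_inj_on)
  have k: "k \<in> {1..r}" using assms by simp
  have others: "prime_factors n - {p k} = p ` ({1..r} - {k})"
    using inj_on_image_set_diff[OF inj, of "{1..r}" "{k}"] k assms(5) by simp
  have P: "p k \<in> prime_factors n" using k assms(5) by simp
  have "(if k = 1 then 2 else 1) \<in> {1..r} - {k}" using assms by auto
  then obtain Q where "Q \<in> prime_factors n" "Q \<noteq> p k" using others by blast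
  then have "minimal_separating_set (reduced_power_graph n) (mixed_multiples n (p k))"
    using minimal_separating_set_mixed_multiples[OF assms(1,2) P] by blast
  also have "mixed_multiples n (p k) =
      (\<Union>i\<in>{1..r} - {k}. cyclic_subgroup_star n (residue_class n (p i * p k)))"
    unfolding Union_cyclic_subgroup_star_eq[OF assms(1) P, symmetric] others by simp
  finally show ?thesis .
qed

end
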